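(* For $m\ge 2$, let $G=K_{a_1,a_2,\ldots,a_m}$ be a complete $m$-partite graph of order $n=\sum_{i=1}^m a_i\ge 3$ (with each $a_i\ge 1$). For every positive integer $k$, $$\gamma_L^k(G)=\begin{cases}\dim_k(G)+1=n-1 & \text{if } k=1 \text{ and } G=K_{1,n-1},\\ \dim_k(G) & \text{otherwise.}\end{cases}$$
   Context: All graphs are finite, simple, undirected and connected. $K_{a_1,\ldots,a_m}$ is the complete $m$-partite graph with parts of sizes $a_1,\ldots,a_m$, and $K_{1,n-1}$ is the complete bipartite graph with parts of sizes $1$ and $n-1$. $d(x,y)$ is the length of a shortest path between $x$ and $y$ in $G$. For a positive integer $k$, let $d_k(x,y)=\min\{d(x,y),k+1\}$. A set $D\subseteq V(G)$ is a distance-$k$ dominating set of $G$ if for each $u\in V(G)\setminus D$ there is $w\in D$ with $d(u,w)\le k$. A set $S\subseteq V(G)$ is a distance-$k$ resolving set of $G$ if for any distinct $x,y\in V(G)$ there is $z\in S$ with $d_k(x,z)\ne d_k(y,z)$; the distance-$k$ dimension $\dim_k(G)$ is the minimum cardinality of a distance-$k$ resolving set. A distance-$k$ locating-dominating set of $G$ is a set $S\subseteq V(G)$ that is both a distance-$k$ dominating set and a distance-$k$ resolving set of $G$; the distance-$k$ location-domination number $\gamma_L^k(G)$ is the minimum cardinality of such a set. *)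

theory Defs
  imports "Graph_Theory.Graph_Theory"
begin

text \<open>
  As in \<^theory>\<open>Graph_Theory.Digraph\<close>, a finite simple undirected graph is a finite symmetric
  digraph without loops and parallel arcs, i.e. an instance of the locale \<^locale>\<open>graph\<close>.
  The following predicate extends \<^const>\<open>complete_bipartite_digraph\<close> to \<open>m\<close> parts
  of sizes \<open>a 1, \<dots>, a m\<close>; the parts are finite because \<open>G\<close> is.
\<close>

definition complete_multipartite_digraph ::
    "nat \<Rightarrow> (nat \<Rightarrow> nat) \<Rightarrow> ('v, 'e) pre_digraph \<Rightarrow> bool" where
  "complete_multipartite_digraph m a G \<longleftrightarrow> graph G \<and>
     (\<exists>P. verts G = (\<Union>i\<in>{1..m}. P i) \<and>
          (\<forall>i\<in>{1..m}. \<forall>j\<in>{1..m}. i \<noteq> j \<longrightarrow> P i \<inter> P j = {}) \<and>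
          (\<forall>i\<in>{1..m}. card (P i) = a i) \<and>
          arcs_ends G = (\<Union>i\<in>{1..m}. \<Union>j\<in>{1..m} - {i}. P i \<times> P j))"

text \<open>
  The distance is the infimum of walk costs under unit arc weights, hence the length of a
  shortest path (and \<open>\<infinity>\<close> if there is none).
\<close>

definition graph_dist :: "('v, 'e) pre_digraph \<Rightarrow> 'v \<Rightarrow> 'v \<Rightarrow> ereal" where
  "graph_dist G x y = wf_digraph.\<mu> G (\<lambda>_. 1) x y"

definition trunc_dist :: "('v, 'e) pre_digraph \<Rightarrow> nat \<Rightarrow> 'v \<Rightarrow> 'v \<Rightarrow> ereal" where
  "trunc_dist G k x y = min (graph_dist G x y) (ereal (real (k + 1)))"

definition distance_dominating_set :: "('v, 'e) pre_digraph \<Rightarrow> nat \<Rightarrow> 'v set \<Rightarrow> bool" where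
  "distance_dominating_set G k D \<longleftrightarrow> D \<subseteq> verts G \<and>
     (\<forall>u\<in>verts G - D. \<exists>w\<in>D. graph_dist G u w \<le> ereal (real k))"

definition distance_resolving_set :: "('v, 'e) pre_digraph \<Rightarrow> nat \<Rightarrow> 'v set \<Rightarrow> bool" where
  "distance_resolving_set G k S \<longleftrightarrow> S \<subseteq> verts G \<and>
     (\<forall>x\<in>verts G. \<forall>y\<in>verts G. x \<noteq> y \<longrightarrow> (\<exists>z\<in>S. trunc_dist G k x z \<noteq> trunc_dist G k y z))"

definition distance_locating_dominating_set ::
    "('v, 'e) pre_digraph \<Rightarrow> nat \<Rightarrow> 'v set \<Rightarrow> bool" where
  "distance_locating_dominating_set G k S \<longleftrightarrow>
     distance_dominating_set G k S \<and> distance_resolving_set G k S"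

text \<open>
  For finite \<open>G\<close> both minima exist, since \<^term>\<open>verts G\<close> is itself such a set.
\<close>

definition distance_dim :: "('v, 'e) pre_digraph \<Rightarrow> nat \<Rightarrow> nat" where
  "distance_dim G k = (LEAST c. \<exists>S. distance_resolving_set G k S \<and> card S = c)"

definition location_domination_number :: "('v, 'e) pre_digraph \<Rightarrow> nat \<Rightarrow> nat" where
  "location_domination_number G k =
     (LEAST c. \<exists>S. distance_locating_dominating_set G k S \<and> card S = c)"

end

(*
  Distances in a complete multipartite graph are at most 2, so the truncated distance is the
  distance, and a set S resolves two distinct vertices outside S iff some member of S is adjacent
  to exactly one of them. For k >= 2 every nonempty set dominates. For k = 1, suppose that a
  resolving set S does not dominate u. Then S lies in the part of u, so any two vertices outside
  this part look alike from S; hence there is only one such vertex and G is a star. In a star a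
  resolving set misses at most one leaf: all leaves but one resolve, but they do not dominate the
  remaining leaf.
*)
theory Submission
  imports Defs
begin

section \<open>Distances, resolution and domination in graphs of diameter at most two\<close>

locale diameter_two_graph = graph +
  assumes common_neighbour:
    "\<lbrakk>x \<in> verts G; y \<in> verts G; x \<noteq> y; \<not> x \<rightarrow> y\<rbrakk> \<Longrightarrow> \<exists>w. x \<rightarrow> w \<and> w \<rightarrow> y"
begin

lemma awalk_cost_unit: "awalk_cost (\<lambda>_. 1) p = real (length p)"
  by (induction p) auto

text \<open>Walks of lengths 0, 1 and 2 exist in the three cases, the last through a common
  neighbour. A walk of length 0 forces equality and one of length 1 forces adjacency, so no shorter
  walk exists.\<close>

lemma graph_dist_eq:
  assumes x: "x \<in> verts G" and y: "y \<in> verts G"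
  shows "graph_dist G x y = (if x = y then 0 else if x \<rightarrow> y then 1 else 2)"
proof -
  \<comment> \<open>The infimum defining the distance is attained at any walk that is no longer than
    all the others.\<close>
  have dist: "graph_dist G x y = ereal (real (length p))"
    if p: "awalk x p y" and least: "\<And>q. awalk x q y \<Longrightarrow> length p \<le> length q" for p
    unfolding graph_dist_def \<mu>_def awalk_cost_unit
    by (rule INF_eqI) (use p least in auto)
  have len0: "x = y" if "awalk x q y" "length q = 0" for q
    using that by (auto simp: awalk_Nil_iff)
  have len1: "x \<rightarrow> y" if "awalk x q y" "length q = 1" for q
    using that by (auto simp: length_Suc_conv awalk_simps arcs_ends_conv)
  consider "x = y" | "x \<noteq> y" "x \<rightarrow> y" | "x \<noteq> y" "\<not> x \<rightarrow> y" by blast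
  then show ?thesis
  proof cases
    case 1
    then have "awalk x [] y" using x by (simp add: awalk_Nil_iff)
    from dist[OF this] 1 show ?thesis by (simp add: zero_ereal_def)
  next
    case 2
    then obtain e where "e \<in> arcs G" "tail G e = x" "head G e = y" by blast
    then have "awalk x [e] y" by (auto simp: awalk_simps)
    moreover have "length [e] \<le> length q" if "awalk x q y" for q
      using len0[OF that] 2 by (cases q) auto
    ultimately show ?thesis using dist[of "[e]"] 2 by (simp add: one_ereal_def)
  next
    case 3
    then obtain w where "x \<rightarrow> w" "w \<rightarrow> y" using common_neighbour x y by blast
    then obtain e e' where "e \<in> arcs G" "tail G e = x" "head G e = w"
      "e' \<in> arcs G" "tail G e' = w" "head G e' = y" by blast
    then have "awalk x [e, e'] y" by (auto simp: awalk_simps)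
    moreover have "length [e, e'] \<le> length q" if "awalk x q y" for q
      using len0[OF that] len1[OF that] 3 by (cases "length q" rule: nat.exhaust) (fastforce, force)
    ultimately show ?thesis using dist[of "[e, e']"] 3 by simp
  qed
qed

text \<open>The cap \<open>k + 1\<close> is at least 2, and no distance exceeds 2.\<close>

lemma trunc_dist_eq:
  assumes "x \<in> verts G" "y \<in> verts G" "k \<ge> 1"
  shows "trunc_dist G k x y = graph_dist G x y"
  using assms by (auto simp: trunc_dist_def graph_dist_eq min_def zero_ereal_def one_ereal_def)

text \<open>A member of \<open>S\<close> is at distance 0 only from itself, so it resolves every
  pair containing it. From a vertex outside \<open>S\<close>, the distance to a member of
  \<open>S\<close> is 1 or 2, and adjacency tells which.\<close>

lemma distance_resolving_set_iff:
  assumes "k \<ge> 1"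
  shows "distance_resolving_set G k S \<longleftrightarrow> S \<subseteq> verts G \<and>
    (\<forall>x\<in>verts G - S. \<forall>y\<in>verts G - S. x \<noteq> y \<longrightarrow> (\<exists>z\<in>S. x \<rightarrow> z \<longleftrightarrow> \<not> y \<rightarrow> z))"
proof (cases "S \<subseteq> verts G")
  case True
  have zero: "graph_dist G x z = 0 \<longleftrightarrow> x = z" if "x \<in> verts G" "z \<in> verts G" for x z
    using that by (simp add: graph_dist_eq)
  have outside: "graph_dist G x z \<noteq> graph_dist G y z \<longleftrightarrow> (x \<rightarrow> z \<longleftrightarrow> \<not> y \<rightarrow> z)"
    if "x \<in> verts G - S" "y \<in> verts G - S" "z \<in> S" for x y z
  proof -
    have "z \<in> verts G" "x \<noteq> z" "y \<noteq> z" using that True by auto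
    then show ?thesis using that by (simp add: graph_dist_eq)
  qed
  have "(\<exists>z\<in>S. trunc_dist G k x z \<noteq> trunc_dist G k y z) \<longleftrightarrow>
      x \<in> S \<or> y \<in> S \<or> (\<exists>z\<in>S. x \<rightarrow> z \<longleftrightarrow> \<not> y \<rightarrow> z)"
    if xy: "x \<in> verts G" "y \<in> verts G" "x \<noteq> y" for x y
  proof -
    have "(\<exists>z\<in>S. trunc_dist G k x z \<noteq> trunc_dist G k y z) \<longleftrightarrow>
        (\<exists>z\<in>S. graph_dist G x z \<noteq> graph_dist G y z)"
      using xy True assms by (intro bex_cong refl) (auto simp: trunc_dist_eq)
    moreover have "\<exists>z\<in>S. graph_dist G x z \<noteq> graph_dist G y z" if "x \<in> S \<or> y \<in> S"
      using that xy zero by metis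
    moreover have "(\<exists>z\<in>S. graph_dist G x z \<noteq> graph_dist G y z) \<longleftrightarrow> (\<exists>z\<in>S. x \<rightarrow> z \<longleftrightarrow> \<not> y \<rightarrow> z)"
      if "x \<notin> S" "y \<notin> S"
      using that xy by (intro bex_cong refl outside) auto
    ultimately show ?thesis by blast
  qed
  then show ?thesis using True unfolding distance_resolving_set_def by blast
qed (auto simp: distance_resolving_set_def)

lemma distance_resolving_setE:
  assumes "distance_resolving_set G k S" "k \<ge> 1" "x \<in> verts G - S" "y \<in> verts G - S" "x \<noteq> y"
  obtains z where "z \<in> S" "x \<rightarrow> z \<longleftrightarrow> \<not> y \<rightarrow> z"
proof -
  have "\<forall>x\<in>verts G - S. \<forall>y\<in>verts G - S. x \<noteq> y \<longrightarrow> (\<exists>z\<in>S. x \<rightarrow> z \<longleftrightarrow> \<not> y \<rightarrow> z)"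
    using assms(1) by (rule distance_resolving_set_iff[OF assms(2), THEN iffD1, THEN conjunct2])
  from this[THEN bspec, OF assms(3), THEN bspec, OF assms(4), THEN mp, OF assms(5)]
  show ?thesis by (elim bexE) (rule that)
qed

lemma distance_dominating_set_1_iff:
  "distance_dominating_set G 1 D \<longleftrightarrow> D \<subseteq> verts G \<and> (\<forall>u\<in>verts G - D. \<exists>w\<in>D. u \<rightarrow> w)"
proof (cases "D \<subseteq> verts G")
  case True
  have "graph_dist G u w \<le> ereal (real 1) \<longleftrightarrow> u \<rightarrow> w" if "u \<in> verts G - D" "w \<in> D" for u w
  proof -
    have "w \<in> verts G" "u \<noteq> w" using that True by auto
    then show ?thesis using that by (simp add: graph_dist_eq one_ereal_def)
  qed
  then show ?thesis unfolding distance_dominating_set_def by blast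
qed (auto simp: distance_dominating_set_def)

lemma distance_dominating_set_ge_2:
  assumes "k \<ge> 2" "D \<subseteq> verts G" "D \<noteq> {}"
  shows "distance_dominating_set G k D"
proof -
  obtain w where "w \<in> D" using assms(3) by blast
  moreover have "graph_dist G u w \<le> ereal (real k)" if "u \<in> verts G" "w \<in> verts G" for u
    using that assms(1) by (simp add: graph_dist_eq zero_ereal_def one_ereal_def)
  ultimately show ?thesis using assms(2) unfolding distance_dominating_set_def by blast
qed

end

text \<open>Both minima then range over the same family of sets. This settles every case except the
  star with \<open>k = 1\<close>.\<close>

lemma location_domination_number_eq_distance_dim:
  assumes "\<And>S. distance_resolving_set G k S \<Longrightarrow> distance_dominating_set G k S"
  shows "location_domination_number G k = distance_dim G k"
proof -
  have "distance_locating_dominating_set G k S \<longleftrightarrow> distance_resolving_set G k S" for S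
    using assms by (auto simp: distance_locating_dominating_set_def)
  then show ?thesis by (simp add: location_domination_number_def distance_dim_def)
qed

text \<open>Trades the family of parts for a colouring \<open>f\<close> under which adjacency just
  means different colours. All \<open>m\<close> colours occur because no part is empty.\<close>

lemma complete_multipartite_digraph_colouring:
  assumes "complete_multipartite_digraph m a G" "\<forall>i\<in>{1..m}. a i \<ge> 1"
  obtains f :: "'v \<Rightarrow> nat"
    where "arcs_ends (G :: ('v, 'e) pre_digraph) =
      {(x, y). x \<in> verts G \<and> y \<in> verts G \<and> f x \<noteq> f y}"
    and "f ` verts G = {1..m}" and "card (verts G) = (\<Sum>i=1..m. a i)"
proof -
  interpret graph G using assms by (simp add: complete_multipartite_digraph_def)
  obtain P where V: "verts G = (\<Union>i\<in>{1..m}. P i)"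
    and disj: "\<forall>i\<in>{1..m}. \<forall>j\<in>{1..m}. i \<noteq> j \<longrightarrow> P i \<inter> P j = {}"
    and cardP: "\<forall>i\<in>{1..m}. card (P i) = a i"
    and E: "arcs_ends G = (\<Union>i\<in>{1..m}. \<Union>j\<in>{1..m} - {i}. P i \<times> P j)"
    using assms(1) unfolding complete_multipartite_digraph_def by (elim conjE exE) (rule that)
  \<comment> \<open>Disjointness of the parts makes the index unique for every vertex; the value
    elsewhere is irrelevant.\<close>
  define f where "f x = (THE i. i \<in> {1..m} \<and> x \<in> P i)" for x
  have f: "f x = i" if "i \<in> {1..m}" "x \<in> P i" for x i
    unfolding f_def using that disj by (intro the_equality) blast+
  have fin: "finite (P i)" if "i \<in> {1..m}" for i
    using that V finite_verts by (metis UN_upper finite_subset)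
  have "\<exists>x. x \<in> P i" if "i \<in> {1..m}" for i
    using that cardP assms(2) by (metis card.empty ex_in_conv not_one_le_zero)
  then have "f ` verts G = {1..m}"
    unfolding V using f by (fastforce simp del: atLeastAtMost_iff)
  moreover have "(x, y) \<in> arcs_ends G \<longleftrightarrow> x \<in> verts G \<and> y \<in> verts G \<and> f x \<noteq> f y" for x y
  proof
    assume "(x, y) \<in> arcs_ends G"
    then obtain i j where "i \<in> {1..m}" "j \<in> {1..m}" "i \<noteq> j" "x \<in> P i" "y \<in> P j"
      unfolding E by blast
    then show "x \<in> verts G \<and> y \<in> verts G \<and> f x \<noteq> f y" unfolding V using f by blast
  next
    assume "x \<in> verts G \<and> y \<in> verts G \<and> f x \<noteq> f y"
    then obtain i j where "i \<in> {1..m}" "j \<in> {1..m}" "x \<in> P i" "y \<in> P j" "f x \<noteq> f y"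
      unfolding V by blast
    moreover from this have "i \<noteq> j" using f by metis
    ultimately show "(x, y) \<in> arcs_ends G" unfolding E by blast
  qed
  then have "arcs_ends G = {(x, y). x \<in> verts G \<and> y \<in> verts G \<and> f x \<noteq> f y}" by auto
  moreover have "card (verts G) = (\<Sum>i=1..m. a i)"
    unfolding V using fin disj cardP by (subst card_UN_disjoint) auto
  ultimately show ?thesis using that by blast
qed

section \<open>Stars with centre \<open>c\<close> and set of leaves \<open>L\<close>\<close>

lemma complete_bipartite_digraph_1E:
  assumes "complete_bipartite_digraph 1 l G"
  obtains c L where "verts G = insert c L" "c \<notin> L" "finite L" "card L = l"
    "\<And>x y. x \<rightarrow>\<^bsub>G\<^esub> y \<longleftrightarrow> x = c \<and> y \<in> L \<or> x \<in> L \<and> y = c"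
proof -
  interpret graph G using assms by (simp add: complete_bipartite_digraph_def)
  obtain U L where UL: "verts G = U \<union> L" "U \<inter> L = {}" "card U = 1" "card L = l"
    "arcs_ends G = U \<times> L \<union> L \<times> U"
    using assms unfolding complete_bipartite_digraph_def by (elim conjE exE) (rule that)
  moreover obtain c where "U = {c}" using UL(3) by (auto simp: card_1_singleton_iff)
  moreover have "finite L" using UL(1) finite_verts by (metis finite_Un)
  ultimately show ?thesis by (intro that[of c L]) auto
qed

text \<open>A resolving set contains all leaves but at most one. If it misses a leaf and also
  dominates, it must contain the centre, which makes up for the missing leaf in the count.\<close>

lemma star_distance_dim_location_domination_number:
  assumes "complete_bipartite_digraph 1 l G" "l \<ge> 2" "diameter_two_graph G"
  shows "distance_dim G 1 = l - 1" "location_domination_number G 1 = l"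
proof -
  interpret diameter_two_graph G by fact
  obtain c L where V: "verts G = insert c L" and c: "c \<notin> L" and fin: "finite L" and l: "card L = l"
    and E: "\<And>x y. x \<rightarrow>\<^bsub>G\<^esub> y \<longleftrightarrow> x = c \<and> y \<in> L \<or> x \<in> L \<and> y = c"
    by (rule complete_bipartite_digraph_1E[OF assms(1)]) (rule that)
  \<comment> \<open>All leaves have \<open>c\<close> as their only neighbour, so adjacency cannot
    separate two of them.\<close>
  have leaf_missed: "x = y"
    if S: "distance_resolving_set G 1 S" and xy: "x \<in> L - S" "y \<in> L - S" for S x y
  proof (rule ccontr)
    assume "x \<noteq> y"
    then obtain z where "x \<rightarrow>\<^bsub>G\<^esub> z \<longleftrightarrow> \<not> y \<rightarrow>\<^bsub>G\<^esub> z"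
      using distance_resolving_setE[OF S, of x y] xy V by auto
    then show False using xy c unfolding E by auto
  qed
  have finite_resolving: "finite S" if "distance_resolving_set G 1 S" for S
    using that finite_subset[OF _ finite_verts] by (simp add: distance_resolving_set_def)
  have lower: "card (L - {x}) \<le> card S" "L - {x} \<subseteq> S"
    if "distance_resolving_set G 1 S" "x \<in> L - S" for S x
  proof -
    have "finite S" using that(1) by (rule finite_resolving)
    moreover show "L - {x} \<subseteq> S" using leaf_missed[OF that] by blast
    ultimately show "card (L - {x}) \<le> card S" by (rule card_mono)
  qed
  have lower': "l \<le> card S" if "distance_resolving_set G 1 S" "L \<subseteq> S" for S
  proof -
    have "finite S" using that(1) by (rule finite_resolving)
    with that(2) l show ?thesis by (metis card_mono)
  qed
  obtain u where u: "u \<in> L" using l assms(2) by fastforce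
  \<comment> \<open>A second leaf \<open>v\<close> is needed to resolve \<open>c\<close> and
    \<open>u\<close>: it is adjacent to \<open>c\<close> but not to \<open>u\<close>.\<close>
  have "card (L - {u}) > 0" using u l assms(2) by simp
  then obtain v where v: "v \<in> L - {u}" by (metis card.empty ex_in_conv less_irrefl)
  have rest: "verts G - (L - {u}) = {c, u}" using c u V by auto
  have res: "distance_resolving_set G 1 (L - {u})"
    unfolding distance_resolving_set_iff[OF order_refl] rest
    using c u v V by (auto simp: E)
  show "distance_dim G 1 = l - 1"
    unfolding distance_dim_def
  proof (rule Least_equality)
    show "\<exists>S. distance_resolving_set G 1 S \<and> card S = l - 1"
      using res u l fin by (intro exI[of _ "L - {u}"]) simp
  next
    fix b assume "\<exists>S. distance_resolving_set G 1 S \<and> card S = b"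
    then obtain S where S: "distance_resolving_set G 1 S" "card S = b" by blast
    show "l - 1 \<le> b"
    proof (cases "L \<subseteq> S")
      case True then show ?thesis using lower' S by fastforce
    next
      case False
      then obtain x where x: "x \<in> L - S" by blast
      then show ?thesis using lower(1)[OF S(1) x] S(2) l fin by simp
    qed
  qed
  show "location_domination_number G 1 = l"
    unfolding location_domination_number_def
  proof (rule Least_equality)
    \<comment> \<open>With one vertex left outside \<open>L\<close>, there is no pair to resolve,
      and the leaf \<open>u\<close> dominates \<open>c\<close>.\<close>
    have "verts G - L = {c}" using c V by auto
    then have "distance_locating_dominating_set G 1 L"
      unfolding distance_locating_dominating_set_def distance_dominating_set_1_iff
        distance_resolving_set_iff[OF order_refl]
      using u V by (auto simp: E)
    then show "\<exists>S. distance_locating_dominating_set G 1 S \<and> card S = l" using l by blast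
  next
    fix b assume "\<exists>S. distance_locating_dominating_set G 1 S \<and> card S = b"
    then obtain S where S: "distance_resolving_set G 1 S" "distance_dominating_set G 1 S" "card S = b"
      unfolding distance_locating_dominating_set_def by blast
    show "l \<le> b"
    proof (cases "L \<subseteq> S")
      case True then show ?thesis using lower' S by blast
    next
      case False
      then obtain x where x: "x \<in> L - S" by blast
      then obtain w where "w \<in> S" "x \<rightarrow>\<^bsub>G\<^esub> w"
        using S(2) V unfolding distance_dominating_set_1_iff by (metis DiffD1 DiffD2 DiffI insertI2)
      \<comment> \<open>The omitted leaf \<open>x\<close> can be dominated only by its sole
        neighbour.\<close>
      then have "c \<in> S" using x c unfolding E by auto
      then have "insert c (L - {x}) \<subseteq> S" using lower(2)[OF S(1) x] by blast
      moreover have "finite S" using S(1) by (rule finite_resolving)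
      ultimately have "card (insert c (L - {x})) \<le> card S" by (intro card_mono)
      moreover have "card (insert c (L - {x})) = card L"
        using c x fin by (metis DiffD1 card.remove card_insert_disjoint finite_Diff)
      ultimately show ?thesis using S(3) l by simp
    qed
  qed
qed

section \<open>Complete multipartite graphs: the star case and the remaining cases\<close>

theorem proposition4p5:
  fixes G :: "('v, 'e) pre_digraph"
    and a :: "nat \<Rightarrow> nat"
    and m n k :: nat
  assumes "m \<ge> 2"
    and "\<forall>i\<in>{1..m}. a i \<ge> 1"
    and "complete_multipartite_digraph m a G"
    and "n = (\<Sum>i=1..m. a i)"
    and "n \<ge> 3"
    and "k \<ge> 1"
  shows "if k = 1 \<and> complete_bipartite_digraph 1 (n - 1) G
         then location_domination_number G k = distance_dim G k + 1 \<and> distance_dim G k + 1 = n - 1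
         else location_domination_number G k = distance_dim G k"
proof -
  interpret graph G using assms(3) by (simp add: complete_multipartite_digraph_def)
  obtain f :: "'v \<Rightarrow> nat"
    where E: "arcs_ends G = {(x, y). x \<in> verts G \<and> y \<in> verts G \<and> f x \<noteq> f y}"
    and f: "f ` verts G = {1..m}" and n: "card (verts G) = n"
    by (rule complete_multipartite_digraph_colouring[OF assms(3,2)]) (simp add: that assms(4))
  \<comment> \<open>Colours 1 and 2 both occur, and \<open>i\<close> differs from at least one of
    them.\<close>
  have other_part: "\<exists>w\<in>verts G. f w \<noteq> i" for i
  proof -
    have "1 \<in> f ` verts G" "2 \<in> f ` verts G" using f assms(1) by auto
    then obtain v w where "v \<in> verts G" "f v = 1" "w \<in> verts G" "f w = 2" by (metis imageE)
    moreover from this have "f v \<noteq> i \<or> f w \<noteq> i" by auto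
    ultimately show ?thesis by blast
  qed
  \<comment> \<open>Nonadjacent vertices share a colour, so any vertex of another colour is a common
    neighbour.\<close>
  have diam: "diameter_two_graph G"
  proof
    fix x y assume xy: "x \<in> verts G" "y \<in> verts G" "\<not> x \<rightarrow>\<^bsub>G\<^esub> y"
    obtain w where "w \<in> verts G" "f w \<noteq> f x" using other_part by blast
    moreover have "f y = f x" using xy by (simp add: E)
    ultimately have "x \<rightarrow>\<^bsub>G\<^esub> w \<and> w \<rightarrow>\<^bsub>G\<^esub> y" using xy by (simp add: E)
    then show "\<exists>w. x \<rightarrow>\<^bsub>G\<^esub> w \<and> w \<rightarrow>\<^bsub>G\<^esub> y" ..
  qed
  interpret diameter_two_graph G by (rule diam)
  show ?thesis
  proof (cases "k = 1 \<and> complete_bipartite_digraph 1 (n - 1) G")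
    case True
    \<comment> \<open>The star has \<open>n - 1\<close> leaves, at least two by
      \<open>n \<ge> 3\<close>; hence adding 1 to \<open>n - 1 - 1\<close> really gives
      \<open>n - 1\<close>.\<close>
    then show ?thesis
      using star_distance_dim_location_domination_number[of "n - 1" G] diam assms(5) by auto
  next
    case False
    have "distance_dominating_set G k S" if "distance_resolving_set G k S" for S
    proof -
      note res = distance_resolving_setE[OF that assms(6)]
      have sub: "S \<subseteq> verts G" using that by (simp add: distance_resolving_set_def)
      show ?thesis
      proof (cases "k = 1")
        case k: True
        show ?thesis
        proof (rule ccontr)
          assume "\<not> distance_dominating_set G k S"
          then obtain u where u: "u \<in> verts G - S" and undominated: "\<forall>w\<in>S. \<not> u \<rightarrow>\<^bsub>G\<^esub> w"
            using sub k distance_dominating_set_1_iff[of S] by auto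
          have S: "f w = f u" if "w \<in> S" for w
            using that undominated u sub unfolding E by auto
          obtain c where c: "c \<in> verts G" "f c \<noteq> f u" using other_part by blast
          \<comment> \<open>All of \<open>S\<close> has the colour of \<open>u\<close>, so
            \<open>x\<close> and \<open>c\<close> lie outside \<open>S\<close> and are adjacent to
            every member of it; nothing in \<open>S\<close> could separate them.\<close>
          have uniq: "x = c" if "x \<in> verts G" "f x \<noteq> f u" for x
          proof (rule ccontr)
            assume "x \<noteq> c"
            moreover have "x \<in> verts G - S" "c \<in> verts G - S" using that c S by auto
            ultimately obtain z where "z \<in> S" "x \<rightarrow>\<^bsub>G\<^esub> z \<longleftrightarrow> \<not> c \<rightarrow>\<^bsub>G\<^esub> z"
              using res by metis
            then show False using that c S sub unfolding E by auto
          qed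
          \<comment> \<open>As \<open>c\<close> is the only vertex coloured differently from
            \<open>u\<close>, the set \<open>L\<close> is the colour class of \<open>u\<close> and
            forms the leaves.\<close>
          define L where "L = verts G - {c}"
          have V: "verts G = insert c L" using c by (auto simp: L_def)
          have "f x = f u" if "x \<in> L" for x
            using that uniq by (auto simp: L_def)
          then have E': "arcs_ends G = {c} \<times> L \<union> L \<times> {c}"
            using c(2) unfolding E V by auto
          have "complete_bipartite_digraph 1 (n - 1) G"
            unfolding complete_bipartite_digraph_def
          proof (intro conjI exI)
            show "graph G" by unfold_locales
            show "verts G = {c} \<union> L" "{c} \<inter> L = {}" using c by (auto simp: L_def)
            show "card {c} = 1" by simp
            show "card L = n - 1" using c n by (simp add: L_def)
          qed (rule E')
          with False k show False by blast
        qed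
      next
        case k: False
        \<comment> \<open>The empty set resolves no pair, and two distinct vertices exist because
          two colours occur.\<close>
        have "S \<noteq> {}"
        proof
          assume "S = {}"
          moreover obtain x where x: "x \<in> verts G" using other_part by blast
          moreover obtain y where "y \<in> verts G" "f y \<noteq> f x" using other_part by blast
          ultimately show False using res[of x y] by auto
        qed
        with k assms(6) sub show ?thesis by (intro distance_dominating_set_ge_2) auto
      qed
    qed
    then have "location_domination_number G k = distance_dim G k"
      by (rule location_domination_number_eq_distance_dim)
    with False show ?thesis by (simp only: if_False)
  qed
qed

end
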